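(* Let $d\ge 1$ and let $X$ be a finite simplicial complex on vertex set $V$ all of whose missing faces have dimension equal to $d$. Then $$\Gamma(X)\le\binom{\tilde\gamma(X)}{d}.$$
   Context: A finite simplicial complex $X$ on a finite vertex set $V$ is a downward closed family of subsets of $V$ containing $\emptyset$ and every singleton $\{v\}$, $v\in V$; $\dim\sigma=|\sigma|-1$. A set $\sigma\subset V$ is a missing face of $X$ if $\sigma\notin X$ but every proper subset of $\sigma$ belongs to $X$. For vertices $v,w$ and a set $\sigma$, write $v\sigma=\{v\}\cup\sigma$ and $vw\sigma=\{v,w\}\cup\sigma$. Total domination number: a subset $S\subset V$ is totally dominating if for every $v\in V$ there is $\sigma\subset S$ such that $\sigma\in X$ but $v\sigma\notin X$. $\tilde\gamma(X)$ is the minimal size of a totally dominating set ($+\infty$ if there is none, in which case $\binom{\tilde\gamma(X)}{d}=+\infty$). Vector domination number: let $\mathcal M_i(X)$ be the set of missing faces of $X$ of dimension $i$, $J_X=\{i:\mathcal M_i(X)\ne\emptyset\}$, and $S(X)=\bigcup_{i\in J_X}\binom{V}{i-1}$, where $\binom{V}{j}$ is the set of $j$-element subsets of $V$. For $\sigma\in S(X)$, a vector representation of $X$ with respect to $\sigma$ is a map $P_\sigma:V\to\mathbb R^{\ell}$ (for some $\ell=\ell(\sigma)\in\mathbb N$) such that $P_\sigma(v)\cdot P_\sigma(w)\ge 1$ if $vw\sigma\in\mathcal M_{|\sigma|+1}(X)$ and $P_\sigma(v)\cdot P_\sigma(w)\ge 0$ otherwise ($v,w\in V$). Identify $P_\sigma$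 with the $|V|\times\ell$ matrix whose rows are the vectors $P_\sigma(v)$. A vector representation of $X$ is a collection $P=\{P_\sigma:\sigma\in S(X)\}$ of such maps. A family of non-negative (row) vectors $\{\alpha_\sigma\in\mathbb R^V:\sigma\in S(X)\}$ is dominating for $P$ if $\sum_{\sigma\in S(X)}\alpha_\sigma P_\sigma P_\sigma^T\ge\mathbf 1$ coordinatewise, where $\mathbf 1$ is the all-ones vector. The value of $P$ is $|P|=\min\{\sum_{\sigma\in S(X)}\alpha_\sigma\cdot\mathbf 1:\{\alpha_\sigma\}\text{ dominating for }P\}$ ($+\infty$ if there is no dominating family). $\Gamma(X)$ is the supremum of $|P|$ over all vector representations $P$ of $X$. *)

theory Defs
  imports "HOL-Library.Extended_Real" "Jordan_Normal_Form.Matrix"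
begin

definition simplicial_complex :: "'a set \<Rightarrow> 'a set set \<Rightarrow> bool" where
  "simplicial_complex V X \<longleftrightarrow>
     finite V \<and> X \<subseteq> Pow V \<and> {} \<in> X \<and> (\<forall>v\<in>V. {v} \<in> X) \<and>
     (\<forall>\<sigma>\<in>X. \<forall>\<tau>. \<tau> \<subseteq> \<sigma> \<longrightarrow> \<tau> \<in> X)"

(* Integer-valued, so that the empty set has dimension -1. *)
definition sdim :: "'a set \<Rightarrow> int" where
  "sdim \<sigma> = int (card \<sigma>) - 1"

definition missing_face :: "'a set \<Rightarrow> 'a set set \<Rightarrow> 'a set \<Rightarrow> bool" where
  "missing_face V X \<sigma> \<longleftrightarrow> \<sigma> \<subseteq> V \<and> \<sigma> \<notin> X \<and> (\<forall>\<tau>. \<tau> \<subset> \<sigma> \<longrightarrow> \<tau> \<in> X)"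

definition missing_faces :: "'a set \<Rightarrow> 'a set set \<Rightarrow> int \<Rightarrow> 'a set set" where
  "missing_faces V X i = {\<sigma>. missing_face V X \<sigma> \<and> sdim \<sigma> = i}"

definition totally_dominating :: "'a set \<Rightarrow> 'a set set \<Rightarrow> 'a set \<Rightarrow> bool" where
  "totally_dominating V X S \<longleftrightarrow>
     S \<subseteq> V \<and> (\<forall>v\<in>V. \<exists>\<sigma>. \<sigma> \<subseteq> S \<and> \<sigma> \<in> X \<and> insert v \<sigma> \<notin> X)"

(* The infimum of the empty set of extended naturals is infinity. *)
definition total_domination_number :: "'a set \<Rightarrow> 'a set set \<Rightarrow> enat" where
  "total_domination_number V X = Inf {enat (card S) | S. totally_dominating V X S}"

fun enat_choose :: "enat \<Rightarrow> nat \<Rightarrow> enat" where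
  "enat_choose (enat n) k = enat (n choose k)"
| "enat_choose \<infinity> k = \<infinity>"

definition J_set :: "'a set \<Rightarrow> 'a set set \<Rightarrow> int set" where
  "J_set V X = {i. missing_faces V X i \<noteq> {}}"

definition S_set :: "'a set \<Rightarrow> 'a set set \<Rightarrow> 'a set set" where
  "S_set V X = (\<Union>i\<in>J_set V X. {\<sigma>. \<sigma> \<subseteq> V \<and> int (card \<sigma>) = i - 1})"

definition vector_representation_at ::
  "'a set \<Rightarrow> 'a set set \<Rightarrow> 'a set \<Rightarrow> ('a \<Rightarrow> real vec) \<Rightarrow> bool" where
  "vector_representation_at V X \<sigma> p \<longleftrightarrow>
     (\<exists>l. \<forall>v\<in>V. p v \<in> carrier_vec l) \<and>
     (\<forall>v\<in>V. \<forall>w\<in>V.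
        if {v, w} \<union> \<sigma> \<in> missing_faces V X (int (card \<sigma>) + 1)
        then p v \<bullet> p w \<ge> 1 else p v \<bullet> p w \<ge> 0)"

definition vector_representation ::
  "'a set \<Rightarrow> 'a set set \<Rightarrow> ('a set \<Rightarrow> 'a \<Rightarrow> real vec) \<Rightarrow> bool" where
  "vector_representation V X P \<longleftrightarrow> (\<forall>\<sigma>\<in>S_set V X. vector_representation_at V X \<sigma> (P \<sigma>))"

(* For the matrix P_\<sigma> with rows P \<sigma> v, the (v, w) entry of P_\<sigma> P_\<sigma>^T is P \<sigma> v \<bullet> P \<sigma> w;
   the last line is thus the w-coordinate of the sum of the row vectors
   \<alpha>_\<sigma> P_\<sigma> P_\<sigma>^T. *)
definition dominating_family ::
  "'a set \<Rightarrow> 'a set set \<Rightarrow> ('a set \<Rightarrow> 'a \<Rightarrow> real vec) \<Rightarrow> ('a set \<Rightarrow> 'a \<Rightarrow> real) \<Rightarrow> bool" where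
  "dominating_family V X P \<alpha> \<longleftrightarrow>
     (\<forall>\<sigma>\<in>S_set V X. \<forall>v\<in>V. \<alpha> \<sigma> v \<ge> 0) \<and>
     (\<forall>w\<in>V. (\<Sum>\<sigma>\<in>S_set V X. \<Sum>v\<in>V. \<alpha> \<sigma> v * (P \<sigma> v \<bullet> P \<sigma> w)) \<ge> 1)"

(* The optimal value of a finite linear program that is bounded below by 0, so the infimum
   is a minimum whenever a dominating family exists, and is infinity otherwise. *)
definition rep_value ::
  "'a set \<Rightarrow> 'a set set \<Rightarrow> ('a set \<Rightarrow> 'a \<Rightarrow> real vec) \<Rightarrow> ereal" where
  "rep_value V X P =
     Inf {ereal (\<Sum>\<sigma>\<in>S_set V X. \<Sum>v\<in>V. \<alpha> \<sigma> v) | \<alpha>. dominating_family V X P \<alpha>}"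

definition vector_domination_number :: "'a set \<Rightarrow> 'a set set \<Rightarrow> ereal" where
  "vector_domination_number V X = Sup {rep_value V X P | P. vector_representation V X P}"

end

theory Submission
  imports Defs
begin

text \<open>
  Let \<open>S\<close> be a totally dominating set. If \<open>\<sigma> \<subseteq> S\<close> is a face and \<open>v\<sigma>\<close> is not, then \<open>v\<sigma>\<close> contains a
  missing face, which must use \<open>v\<close> because \<open>\<sigma>\<close> is a face. As all missing faces have \<open>d + 1\<close> elements,
  every vertex \<open>v\<close> completes some \<open>d\<close>-subset \<open>T\<close> of \<open>S\<close> to a missing face
  (\<open>totally_dominating_completes\<close>).

  Now mark one vertex \<open>u\<close> in each \<open>d\<close>-subset \<open>T\<close> of \<open>S\<close> and give weight \<open>1\<close> to \<open>u\<close> in the coordinate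
  \<open>T - {u}\<close>. These are at most \<open>|S| choose d\<close> units of weight in total, whatever the vector
  representation \<open>P\<close> is. They dominate: if \<open>T\<close> together with \<open>v\<close> is a missing face, then the defining
  inequality of \<open>P\<close> at \<open>T - {u}\<close> says that the vectors of \<open>u\<close> and \<open>v\<close> have inner product at least \<open>1\<close>,
  and all other contributions at \<open>v\<close> are nonnegative (\<open>rep_value_le_choose\<close>). The theorem is the case
  of a totally dominating set of least size; if there is none, the bound is infinite.
\<close>

lemma nonface_contains_missing_face:
  assumes "finite V" "\<rho> \<subseteq> V" "\<rho> \<notin> X"
  obtains \<tau> where "\<tau> \<subseteq> \<rho>" "missing_face V X \<tau>"
proof -
  let ?N = "{\<tau>. \<tau> \<subseteq> \<rho> \<and> \<tau> \<notin> X}"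
  have "finite ?N"
    using assms by (auto intro: finite_subset[of _ "Pow \<rho>"] dest: finite_subset)
  moreover have "\<rho> \<in> ?N"
    using assms by simp
  ultimately obtain \<tau> where \<tau>: "\<tau> \<in> ?N" "\<forall>\<rho>'\<in>?N. \<rho>' \<subseteq> \<tau> \<longrightarrow> \<tau> = \<rho>'"
    using finite_has_minimal2[of ?N \<rho>] by blast
  then have "missing_face V X \<tau>"
    using assms(2) unfolding missing_face_def by blast
  with \<tau>(1) show thesis
    using that by blast
qed

text \<open>
  The missing face is found inside \<open>v\<sigma>\<close>, where \<open>\<sigma> \<subseteq> S\<close> is the face that dominates \<open>v\<close>. The vertex \<open>v\<close>
  may itself lie in \<open>S\<close>, but it cannot lie in \<open>T\<close>, as \<open>T\<close> has one element less than the missing face.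
\<close>

lemma totally_dominating_completes:
  assumes X: "simplicial_complex V X"
    and dim: "\<And>\<sigma>. missing_face V X \<sigma> \<Longrightarrow> sdim \<sigma> = int d"
    and S: "totally_dominating V X S" and v: "v \<in> V"
  obtains T where "T \<subseteq> S" "card T = d" "insert v T \<in> missing_faces V X (int d)"
proof -
  obtain \<sigma> where \<sigma>: "\<sigma> \<subseteq> S" "\<sigma> \<in> X" "insert v \<sigma> \<notin> X"
    using S v unfolding totally_dominating_def by blast
  have finV: "finite V" and "insert v \<sigma> \<subseteq> V"
    using X \<sigma>(2) v unfolding simplicial_complex_def by auto
  then obtain \<tau> where \<tau>: "\<tau> \<subseteq> insert v \<sigma>" "missing_face V X \<tau>"
    using nonface_contains_missing_face \<sigma>(3) by metis
  have "v \<in> \<tau>"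
  proof (rule ccontr)
    assume "v \<notin> \<tau>"
    then have "\<tau> \<in> X"
      using \<tau>(1) \<sigma>(2) X unfolding simplicial_complex_def by blast
    then show False
      using \<tau>(2) unfolding missing_face_def by simp
  qed
  have "finite \<tau>"
    using \<tau>(2) finV unfolding missing_face_def by (auto dest: finite_subset)
  show thesis
  proof (rule that)
    show "\<tau> - {v} \<subseteq> S"
      using \<tau>(1) \<sigma>(1) by blast
    show "card (\<tau> - {v}) = d"
      using dim[OF \<tau>(2)] \<open>v \<in> \<tau>\<close> \<open>finite \<tau>\<close> unfolding sdim_def by simp
    show "insert v (\<tau> - {v}) \<in> missing_faces V X (int d)"
      using \<tau>(2) dim[OF \<tau>(2)] \<open>v \<in> \<tau>\<close> unfolding missing_faces_def by (simp add: insert_absorb)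
  qed
qed

text \<open>
  One weighting serves all vector representations: the pairs \<open>(T - {u}, u)\<close>, with \<open>u\<close> the marked vertex
  of a \<open>d\<close>-subset \<open>T\<close> of \<open>S\<close>, get weight \<open>1\<close> and all other pairs get weight \<open>0\<close>. A nonempty \<open>T\<close> is
  needed to mark a vertex, hence \<open>d \<ge> 1\<close>.
\<close>

lemma rep_value_le_choose:
  assumes d: "d \<ge> 1"
    and X: "simplicial_complex V X"
    and dim: "\<And>\<sigma>. missing_face V X \<sigma> \<Longrightarrow> sdim \<sigma> = int d"
    and S: "totally_dominating V X S"
    and P: "vector_representation V X P"
  shows "rep_value V X P \<le> ereal (real (card S choose d))"
proof -
  have finV: "finite V" and SV: "S \<subseteq> V"
    using X S unfolding simplicial_complex_def totally_dominating_def by auto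
  then have finS: "finite S"
    by (simp add: finite_subset)
  let ?I = "S_set V X"
  have finI: "finite ?I"
    using finV by (auto simp: S_set_def intro: finite_subset[of _ "Pow V"])
  define mark where "mark T = (SOME u. u \<in> T)" for T :: "'a set"
  define E where "E = (\<lambda>T. (T - {mark T}, mark T)) ` {T. T \<subseteq> S \<and> card T = d}"
  define \<alpha> :: "'a set \<Rightarrow> 'a \<Rightarrow> real" where "\<alpha> \<sigma> u = of_bool ((\<sigma>, u) \<in> E)" for \<sigma> u
  have gram_nonneg: "P \<sigma> u \<bullet> P \<sigma> w \<ge> 0" if "\<sigma> \<in> ?I" "u \<in> V" "w \<in> V" for \<sigma> u w
    using P that unfolding vector_representation_def vector_representation_at_def
    by (smt (verit, best))
  have finE: "finite E" and cardE: "card E \<le> card S choose d"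
  proof -
    have fin: "finite {T. T \<subseteq> S \<and> card T = d}"
      using finS by simp
    then show "finite E"
      unfolding E_def by (rule finite_imageI)
    show "card E \<le> card S choose d"
      using card_image_le[OF fin] n_subsets[OF finS, of d] unfolding E_def by metis
  qed
  have "dominating_family V X P \<alpha>"
    unfolding dominating_family_def
  proof (intro conjI ballI)
    fix w assume w: "w \<in> V"
    obtain T where T: "T \<subseteq> S" "card T = d" "insert w T \<in> missing_faces V X (int d)"
      using totally_dominating_completes[OF X dim S w] by blast
    define u where "u = mark T"
    define \<sigma> where "\<sigma> = T - {u}"
    have "T \<noteq> {}"
      using T(2) d by auto
    then have "u \<in> T"
      unfolding u_def mark_def by (simp add: some_in_eq)
    then have uV: "u \<in> V"
      using T(1) SV by blast
    have card_\<sigma>: "int (card \<sigma>) = int d - 1"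
      using \<open>u \<in> T\<close> T(2) d finS finite_subset[OF T(1)] unfolding \<sigma>_def by simp
    \<comment> \<open>The missing face just found witnesses that \<open>d\<close> is one of the dimensions that index \<open>S(X)\<close>.\<close>
    have \<sigma>I: "\<sigma> \<in> ?I"
      using T SV card_\<sigma> unfolding S_set_def J_set_def \<sigma>_def by blast
    have "{u, w} \<union> \<sigma> = insert w T"
      using \<open>u \<in> T\<close> unfolding \<sigma>_def by blast
    then have "{u, w} \<union> \<sigma> \<in> missing_faces V X (int (card \<sigma>) + 1)"
      using T(3) card_\<sigma> by simp
    then have ge1: "P \<sigma> u \<bullet> P \<sigma> w \<ge> 1"
      using P \<sigma>I uV w unfolding vector_representation_def vector_representation_at_def
      by (smt (verit, best))
    have "\<alpha> \<sigma> u = 1"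
      using T unfolding \<alpha>_def E_def u_def \<sigma>_def by auto
    then have "1 \<le> \<alpha> \<sigma> u * (P \<sigma> u \<bullet> P \<sigma> w)"
      using ge1 by simp
    also have "\<dots> \<le> (\<Sum>v\<in>V. \<alpha> \<sigma> v * (P \<sigma> v \<bullet> P \<sigma> w))"
      using member_le_sum[OF uV, of "\<lambda>v. \<alpha> \<sigma> v * (P \<sigma> v \<bullet> P \<sigma> w)"] gram_nonneg[OF \<sigma>I _ w] finV
      by (simp add: \<alpha>_def)
    also have "\<dots> \<le> (\<Sum>\<sigma>\<in>?I. \<Sum>v\<in>V. \<alpha> \<sigma> v * (P \<sigma> v \<bullet> P \<sigma> w))"
      using gram_nonneg w
      by (intro member_le_sum[OF \<sigma>I _ finI, of "\<lambda>\<sigma>. \<Sum>v\<in>V. \<alpha> \<sigma> v * (P \<sigma> v \<bullet> P \<sigma> w)"])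
        (auto intro!: sum_nonneg simp: \<alpha>_def)
    finally show "1 \<le> (\<Sum>\<sigma>\<in>?I. \<Sum>v\<in>V. \<alpha> \<sigma> v * (P \<sigma> v \<bullet> P \<sigma> w))" .
  qed (simp add: \<alpha>_def)
  then have "rep_value V X P \<le> ereal (\<Sum>\<sigma>\<in>?I. \<Sum>v\<in>V. \<alpha> \<sigma> v)"
    unfolding rep_value_def by (intro Inf_lower) blast
  also have "(\<Sum>\<sigma>\<in>?I. \<Sum>v\<in>V. \<alpha> \<sigma> v) = (\<Sum>p\<in>?I \<times> V. of_bool (p \<in> E))"
    by (simp add: sum.cartesian_product \<alpha>_def case_prod_unfold)
  also have "\<dots> = real (card ((?I \<times> V) \<inter> E))"
    using finI finV by (simp add: Int_def)
  also have "ereal \<dots> \<le> ereal (real (card S choose d))"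
    using card_mono[OF finE, of "(?I \<times> V) \<inter> E"] cardE by simp
  finally show ?thesis .
qed

theorem proposition1p5:
  fixes V :: "'a set" and X :: "'a set set" and d :: nat
  assumes "d \<ge> 1"
    and "simplicial_complex V X"
    and "\<And>\<sigma>. missing_face V X \<sigma> \<Longrightarrow> sdim \<sigma> = int d"
  shows "vector_domination_number V X
           \<le> ereal_of_enat (enat_choose (total_domination_number V X) d)"
proof (cases "\<exists>S. totally_dominating V X S")
  case True
  then have "{enat (card S) | S. totally_dominating V X S} \<noteq> {}"
    by blast
  \<comment> \<open>The extended naturals are well-ordered, so the infimum is attained.\<close>
  from wellorder_InfI[of _ "{enat (card S) | S. totally_dominating V X S}"] this
  obtain S where S: "totally_dominating V X S" "total_domination_number V X = enat (card S)"
    unfolding total_domination_number_def by blast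
  show ?thesis
    unfolding vector_domination_number_def S(2)
    using rep_value_le_choose[OF assms S(1)] by (auto intro!: Sup_least)
next
  case False
  then have "total_domination_number V X = \<infinity>"
    unfolding total_domination_number_def by (simp add: top_enat_def)
  then show ?thesis
    by simp
qed

end
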